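(* Let $f_1,\dots,f_M$ and $g_1,\dots,g_N$ be bijections from $(0,\infty)$ to $(0,\infty)$, let $\mathbf A=(a_{ij})$ be an $N\times M$ matrix with $a_{ij}\ge 0$, and let $c_1,\dots,c_N>0$ and $d_1,\dots,d_M>0$. Consider the system in the unknowns $PPP_1,\dots,PPP_M,P_1,\dots,P_N$: $$f_j(PPP_j)=\sum_{n=1}^{N}\frac{a_{nj}c_n}{g_n(P_n)}\quad(j=1,\dots,M),\qquad g_i(P_i)=\sum_{m=1}^{M}\frac{a_{im}d_m}{f_m(PPP_m)}\quad(i=1,\dots,N).$$ Then the system has a unique positive solution (up to a positive scalar factor) if and only if both the compatibility condition for $(\mathbf A,\mathbf c,\mathbf d)$ and the connectedness condition for $\mathbf A$ hold.
   Context: For $I\subseteq\{1,\dots,N\}$, $J\subseteq\{1,\dots,M\}$, $I^c$ and $J^c$ denote complements and $\mathbf A_{IJ}=(a_{ij})_{i\in I,j\in J}$; a block with an empty index set is regarded as equal to $\mathbf 0$. Compatibility condition: for all $I\subseteq\{1,\dots,N\}$ and $J\subseteq\{1,\dots,M\}$ (possibly empty or full) with $\mathbf A_{I^cJ^c}=\mathbf 0$, one has $\sum_{i\in I^c}c_i\le\sum_{j\in J}d_j$, and this inequality is strict if and only if $\mathbf A_{IJ}\neq\mathbf 0$. Connectedness of $\mathbf A$: for all nonempty proper subsets $I\subset\{1,\dots,N\}$ and $J\subset\{1,\dots,M\}$, $\mathbf A_{I^cJ^c}=\mathbf 0$ implies $\mathbf A_{IJ}\neq\mathbf 0$. Unique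 up to a positive scalar factor: a positive solution exists, and for any two positive solutions $(PPP_j,P_i)$, $(PPP'_j,P'_i)$ there is $\delta>0$ with $f_j(PPP'_j)=\delta f_j(PPP_j)$ for all $j$ and $g_i(P'_i)=\delta^{-1}g_i(P_i)$ for all $i$. *)

theory Defs
  imports "HOL-Analysis.Analysis"
begin

text \<open>
  An \<open>N \<times> M\<close> matrix is an element of \<^typ>\<open>real ^ 'm ^ 'n\<close>, with \<open>N = CARD('n) \<ge> 1\<close> rows and
  \<open>M = CARD('m) \<ge> 1\<close> columns.
\<close>

text \<open>A block with an empty index set is zero; here this holds vacuously.\<close>

definition zero_block :: "real ^ 'm ^ 'n \<Rightarrow> 'n set \<Rightarrow> 'm set \<Rightarrow> bool" where
  "zero_block A I J \<longleftrightarrow> (\<forall>i\<in>I. \<forall>j\<in>J. A $ i $ j = 0)"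

definition compatible :: "real ^ 'm ^ 'n \<Rightarrow> real ^ 'n \<Rightarrow> real ^ 'm \<Rightarrow> bool" where
  "compatible A c d \<longleftrightarrow>
     (\<forall>I J. zero_block A (- I) (- J) \<longrightarrow>
        (\<Sum>i\<in>- I. c $ i) \<le> (\<Sum>j\<in>J. d $ j) \<and>
        ((\<Sum>i\<in>- I. c $ i) < (\<Sum>j\<in>J. d $ j) \<longleftrightarrow> \<not> zero_block A I J))"

definition connected_matrix :: "real ^ 'm ^ 'n \<Rightarrow> bool" where
  "connected_matrix A \<longleftrightarrow>
     (\<forall>I J. I \<noteq> {} \<and> I \<noteq> UNIV \<and> J \<noteq> {} \<and> J \<noteq> UNIV \<and> zero_block A (- I) (- J) \<longrightarrow>
        \<not> zero_block A I J)"

text \<open>The unknown \<open>x\<close> is the vector of the \<open>PPP\<^sub>j\<close>, and \<open>y\<close> the vector of the \<open>P\<^sub>i\<close>.\<close>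

definition positive_solution ::
  "('m \<Rightarrow> real \<Rightarrow> real) \<Rightarrow> ('n \<Rightarrow> real \<Rightarrow> real) \<Rightarrow> real ^ 'm ^ 'n \<Rightarrow> real ^ 'n \<Rightarrow> real ^ 'm \<Rightarrow>
   real ^ 'm \<Rightarrow> real ^ 'n \<Rightarrow> bool" where
  "positive_solution f g A c d x y \<longleftrightarrow>
     (\<forall>j. x $ j > 0) \<and> (\<forall>i. y $ i > 0) \<and>
     (\<forall>j. f j (x $ j) = (\<Sum>n\<in>UNIV. A $ n $ j * c $ n / g n (y $ n))) \<and>
     (\<forall>i. g i (y $ i) = (\<Sum>m\<in>UNIV. A $ i $ m * d $ m / f m (x $ m)))"

text \<open>The scalar acts on the values \<open>f j (x $ j)\<close> and, inversely, on \<open>g i (y $ i)\<close>, not on the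
  unknowns themselves.\<close>

definition unique_positive_solution_up_to_scalar ::
  "('m \<Rightarrow> real \<Rightarrow> real) \<Rightarrow> ('n \<Rightarrow> real \<Rightarrow> real) \<Rightarrow> real ^ 'm ^ 'n \<Rightarrow> real ^ 'n \<Rightarrow> real ^ 'm \<Rightarrow> bool" where
  "unique_positive_solution_up_to_scalar f g A c d \<longleftrightarrow>
     (\<exists>x y. positive_solution f g A c d x y) \<and>
     (\<forall>x y x' y'. positive_solution f g A c d x y \<and> positive_solution f g A c d x' y' \<longrightarrow>
        (\<exists>\<delta>>0. (\<forall>j. f j (x' $ j) = \<delta> * f j (x $ j)) \<and>
               (\<forall>i. g i (y' $ i) = inverse \<delta> * g i (y $ i))))"

end

theory Submission
  imports Defs
begin

text \<open>
  With \<open>p\<^sub>i = c\<^sub>i / g\<^sub>i(P\<^sub>i)\<close> and \<open>q\<^sub>j = d\<^sub>j / f\<^sub>j(PPP\<^sub>j)\<close> the system says that the matrix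
  \<open>(p\<^sub>i a\<^sub>i\<^sub>j q\<^sub>j)\<close> has row sums \<open>c\<close> and column sums \<open>d\<close>. Counting mass in blocks shows that the
  compatibility condition is necessary; if connectedness fails, the two nonzero blocks can be
  rescaled independently. Conversely, under connectedness the ratio of two solutions is constant
  by a maximum principle. For existence put \<open>p\<^sub>i = exp a\<^sub>i\<close>, \<open>q\<^sub>j = d\<^sub>j / (\<Sum>\<^sub>k a\<^sub>k\<^sub>j p\<^sub>k)\<close>; the row
  equations are then the critical point equations of the concave function
  \<open>h(a) = \<Sum>\<^sub>i c\<^sub>i a\<^sub>i - \<Sum>\<^sub>j d\<^sub>j ln (\<Sum>\<^sub>k a\<^sub>k\<^sub>j exp a\<^sub>k)\<close>, which is invariant under adding a constant to
  all \<open>a\<^sub>i\<close> and, by the two conditions, tends to \<open>-\<infinity>\<close> linearly in \<open>max a - min a\<close>. Hence it has a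
  maximum.
\<close>

section \<open>The system as a matrix scaling problem\<close>

definition scaling ::
  "real ^ 'm ^ 'n \<Rightarrow> real ^ 'n \<Rightarrow> real ^ 'm \<Rightarrow> ('n::finite \<Rightarrow> real) \<Rightarrow> ('m::finite \<Rightarrow> real) \<Rightarrow> bool"
  where "scaling A c d p q \<longleftrightarrow> (\<forall>i. p i > 0) \<and> (\<forall>j. q j > 0) \<and>
     (\<forall>i. (\<Sum>j\<in>UNIV. p i * A $ i $ j * q j) = c $ i) \<and>
     (\<forall>j. (\<Sum>i\<in>UNIV. p i * A $ i $ j * q j) = d $ j)"

lemma positive_solution_imp_scaling:
  assumes f: "\<And>j. bij_betw (f j) {0<..} {0<..}" and g: "\<And>i. bij_betw (g i) {0<..} {0<..}"
    and c: "\<And>i. c $ i > 0" and d: "\<And>j. d $ j > 0"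
    and sol: "positive_solution f g A c d x y"
  shows "scaling A c d (\<lambda>i. c $ i / g i (y $ i)) (\<lambda>j. d $ j / f j (x $ j))"
proof -
  have xy: "x $ j > 0" "y $ i > 0" for i j
    using sol by (auto simp: positive_solution_def)
  have fp: "f j (x $ j) > 0" for j
    using bij_betwE[OF f] xy by fastforce
  have gp: "g i (y $ i) > 0" for i
    using bij_betwE[OF g] xy by fastforce
  have eqs: "(\<Sum>n\<in>UNIV. A $ n $ j * c $ n / g n (y $ n)) = f j (x $ j)"
    "(\<Sum>m\<in>UNIV. A $ i $ m * d $ m / f m (x $ m)) = g i (y $ i)" for i j
    using sol unfolding positive_solution_def by metis+
  have row: "(\<Sum>j\<in>UNIV. c $ i / g i (y $ i) * A $ i $ j * (d $ j / f j (x $ j))) = c $ i" for i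
  proof -
    have "(\<Sum>j\<in>UNIV. c $ i / g i (y $ i) * A $ i $ j * (d $ j / f j (x $ j)))
        = c $ i / g i (y $ i) * (\<Sum>j\<in>UNIV. A $ i $ j * d $ j / f j (x $ j))"
      unfolding sum_distrib_left by (intro sum.cong refl) (simp add: divide_inverse mult_ac)
    also have "\<dots> = c $ i / g i (y $ i) * g i (y $ i)"
      by (simp only: eqs)
    finally show ?thesis using gp[of i] by simp
  qed
  have col: "(\<Sum>i\<in>UNIV. c $ i / g i (y $ i) * A $ i $ j * (d $ j / f j (x $ j))) = d $ j" for j
  proof -
    have "(\<Sum>i\<in>UNIV. c $ i / g i (y $ i) * A $ i $ j * (d $ j / f j (x $ j)))
        = d $ j / f j (x $ j) * (\<Sum>i\<in>UNIV. A $ i $ j * c $ i / g i (y $ i))"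
      unfolding sum_distrib_left by (intro sum.cong refl) (simp add: divide_inverse mult_ac)
    also have "\<dots> = d $ j / f j (x $ j) * f j (x $ j)"
      by (simp only: eqs)
    finally show ?thesis using fp[of j] by simp
  qed
  show ?thesis
    unfolding scaling_def using row col fp gp c d by auto
qed

text \<open>Surjectivity of \<open>f j\<close> and \<open>g i\<close> onto the positive reals
  realises the values prescribed by \<open>p\<close> and \<open>q\<close>. These values are recorded
  in the conclusion because uniqueness up to a scalar compares them rather than the
  unknowns.\<close>

lemma scaling_imp_positive_solution:
  assumes f: "\<And>j. bij_betw (f j) {0<..} {0<..}" and g: "\<And>i. bij_betw (g i) {0<..} {0<..}"
    and c: "\<And>i. c $ i > 0" and d: "\<And>j. d $ j > 0"
    and sc: "scaling A c d p q"
  obtains x y where "positive_solution f g A c d x y"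
    "\<And>j. f j (x $ j) = d $ j / q j" "\<And>i. g i (y $ i) = c $ i / p i"
proof -
  have p: "p i > 0" and q: "q j > 0" for i j
    using sc by (auto simp: scaling_def)
  have "\<forall>j. \<exists>t>0. f j t = d $ j / q j"
  proof
    fix j
    have "d $ j / q j \<in> f j ` {0<..}"
      unfolding bij_betw_imp_surj_on[OF f] using d q by simp
    then show "\<exists>t>0. f j t = d $ j / q j" by force
  qed
  then obtain X where X: "\<And>j. X j > 0" "\<And>j. f j (X j) = d $ j / q j" by metis
  have "\<forall>i. \<exists>t>0. g i t = c $ i / p i"
  proof
    fix i
    have "c $ i / p i \<in> g i ` {0<..}"
      unfolding bij_betw_imp_surj_on[OF g] using c p by simp
    then show "\<exists>t>0. g i t = c $ i / p i" by force
  qed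
  then obtain Y where Y: "\<And>i. Y i > 0" "\<And>i. g i (Y i) = c $ i / p i" by metis
  have col: "d $ j / q j = (\<Sum>n\<in>UNIV. A $ n $ j * c $ n / (c $ n / p n))" for j
  proof -
    have "d $ j = (\<Sum>n\<in>UNIV. A $ n $ j * c $ n / (c $ n / p n)) * q j"
      using sc less_imp_neq[OF c, THEN not_sym] unfolding sum_distrib_right
      by (simp add: scaling_def mult_ac)
    then show ?thesis using q[of j] by (simp add: field_simps)
  qed
  have row: "c $ i / p i = (\<Sum>m\<in>UNIV. A $ i $ m * d $ m / (d $ m / q m))" for i
  proof -
    have "c $ i = (\<Sum>m\<in>UNIV. A $ i $ m * d $ m / (d $ m / q m)) * p i"
      using sc less_imp_neq[OF d, THEN not_sym] unfolding sum_distrib_right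
      by (simp add: scaling_def mult_ac)
    then show ?thesis using p[of i] by (simp add: field_simps)
  qed
  show thesis
  proof
    show "positive_solution f g A c d (\<chi> j. X j) (\<chi> i. Y i)"
      unfolding positive_solution_def vec_lambda_beta X(2) Y(2)
      using X(1) Y(1) row col by blast
  qed (use X Y in auto)
qed

section \<open>Necessity of the two conditions\<close>

text \<open>The rows outside \<open>I\<close> carry all their mass in the columns of
  \<open>J\<close>. So the two sums differ exactly by the mass of the block \<open>I\<close> times
  \<open>J\<close>, which is nonnegative and vanishes only if all entries of the block do.\<close>

lemma scaling_imp_compatible:
  assumes A: "\<And>i j. A $ i $ j \<ge> 0" and sc: "scaling A c d p q"
  shows "compatible A c d"
  unfolding compatible_def
proof (intro allI impI)
  fix I J assume z: "zero_block A (- I) (- J)"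
  define T where "T i j = p i * A $ i $ j * q j" for i j
  have p: "p i > 0" and q: "q j > 0" for i j
    using sc by (auto simp: scaling_def)
  have T0: "T i j \<ge> 0" for i j
    unfolding T_def using p[of i] q[of j] A by simp
  have Tz: "T i j = 0 \<longleftrightarrow> A $ i $ j = 0" for i j
    unfolding T_def using p[of i] q[of j] by simp
  have row: "(\<Sum>j\<in>UNIV. T i j) = c $ i" and col: "(\<Sum>i\<in>UNIV. T i j) = d $ j" for i j
    using sc by (auto simp: scaling_def T_def)
  have "c $ i = (\<Sum>j\<in>J. T i j)" if "i \<in> - I" for i
    unfolding row[symmetric]
    by (rule sum.mono_neutral_right) (use z that Tz in \<open>auto simp: zero_block_def\<close>)
  then have "(\<Sum>i\<in>- I. c $ i) = (\<Sum>i\<in>- I. \<Sum>j\<in>J. T i j)" by simp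
  then have c: "(\<Sum>i\<in>- I. c $ i) = (\<Sum>j\<in>J. \<Sum>i\<in>- I. T i j)"
    using sum.swap[of T J "- I"] by simp
  have "d $ j = (\<Sum>i\<in>- I. T i j) + (\<Sum>i\<in>I. T i j)" for j
    unfolding col[symmetric]
    using sum.subset_diff[of I UNIV "\<lambda>i. T i j"] by (simp add: Compl_eq_Diff_UNIV)
  then have d: "(\<Sum>j\<in>J. d $ j) = (\<Sum>i\<in>- I. c $ i) + (\<Sum>j\<in>J. \<Sum>i\<in>I. T i j)"
    unfolding c by (simp add: sum.distrib)
  have nn: "(\<Sum>j\<in>J. \<Sum>i\<in>I. T i j) \<ge> 0"
    by (intro sum_nonneg T0)
  have "(\<Sum>j\<in>J. \<Sum>i\<in>I. T i j) = 0 \<longleftrightarrow> zero_block A I J"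
    by (auto simp: sum_nonneg_eq_0_iff sum_nonneg T0 Tz zero_block_def)
  with nn d show "(\<Sum>i\<in>- I. c $ i) \<le> (\<Sum>j\<in>J. d $ j) \<and>
        ((\<Sum>i\<in>- I. c $ i) < (\<Sum>j\<in>J. d $ j) \<longleftrightarrow> \<not> zero_block A I J)"
    by auto
qed

text \<open>A nonzero entry lies either in \<open>I\<close> times \<open>- J\<close>, where the
  factors \<open>t\<close> and \<open>1 / t\<close> cancel, or in \<open>- I\<close> times
  \<open>J\<close>, where nothing changes. This yields non-proportional scalings once connectedness
  fails.\<close>

lemma scaling_rescale_blocks:
  assumes sc: "scaling A c d p q" and z: "zero_block A (- I) (- J)" "zero_block A I J"
    and t: "t > 0"
  shows "scaling A c d (\<lambda>i. if i \<in> I then t * p i else p i) (\<lambda>j. if j \<in> J then q j else q j / t)"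
proof -
  have "(if i \<in> I then t * p i else p i) * A $ i $ j * (if j \<in> J then q j else q j / t)
      = p i * A $ i $ j * q j" for i j
    using z t by (auto simp: zero_block_def)
  then show ?thesis using sc t unfolding scaling_def by (simp only:) simp
qed

section \<open>Uniqueness of scalings\<close>

text \<open>Let \<open>R\<close> be the largest ratio \<open>p' i / p i\<close> and \<sigma> the
  smallest ratio \<open>q' j / q j\<close>. The row attaining \<open>R\<close> gives
  \<open>R * \<sigma> \<le> 1\<close>, the column attaining \<sigma> the reverse. Equality then
  spreads along nonzero entries, and connectedness makes it reach every row and column.\<close>

lemma scaling_unique:
  assumes A: "\<And>i j. A $ i $ j \<ge> 0" and c: "\<And>i. c $ i > 0" and d: "\<And>j. d $ j > 0"
    and con: "connected_matrix A" and sc: "scaling A c d p q" and sc': "scaling A c d p' q'"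
  obtains R where "R > 0" "\<And>i. p' i = R * p i" "\<And>j. q' j = q j / R"
proof -
  define T where "T i j = p i * A $ i $ j * q j" for i j
  define r where "r i = p' i / p i" for i
  define s where "s j = q' j / q j" for j
  have pos: "p i > 0" "q j > 0" "p' i > 0" "q' j > 0" for i j
    using sc sc' by (auto simp: scaling_def)
  have rs: "r i > 0" "s j > 0" for i j
    using pos by (auto simp: r_def s_def)
  have T0: "T i j \<ge> 0" for i j
    unfolding T_def using pos(1)[of i] pos(2)[of j] A by simp
  have Tz: "T i j = 0 \<longleftrightarrow> A $ i $ j = 0" for i j
    unfolding T_def using pos(1)[of i] pos(2)[of j] by simp
  have row: "(\<Sum>j\<in>UNIV. T i j) = c $ i" and col: "(\<Sum>i\<in>UNIV. T i j) = d $ j" for i j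
    using sc by (auto simp: scaling_def T_def)
  have T': "p' i * A $ i $ j * q' j = T i j * (r i * s j)" for i j
    unfolding T_def r_def s_def using pos(1)[of i] pos(2)[of j] by simp
  have row': "(\<Sum>j\<in>UNIV. T i j * (r i * s j)) = c $ i" and
      col': "(\<Sum>i\<in>UNIV. T i j * (r i * s j)) = d $ j" for i j
    using sc' by (auto simp: scaling_def T')
  have rowd: "(\<Sum>j\<in>UNIV. T i j * (r i * s j - 1)) = 0" for i
    by (simp add: right_diff_distrib sum_subtractf row row')
  have cold: "(\<Sum>i\<in>UNIV. T i j * (r i * s j - 1)) = 0" for j
    by (simp add: right_diff_distrib sum_subtractf col col')
  define R where "R = Max (range r)"
  define \<sigma> where "\<sigma> = Min (range s)"
  have rR: "r i \<le> R" for i by (simp add: R_def)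
  have s\<sigma>: "\<sigma> \<le> s j" for j by (simp add: \<sigma>_def)
  have "R \<in> range r" unfolding R_def by (rule Max_in) auto
  then obtain i0 where i0: "r i0 = R" by auto
  have "\<sigma> \<in> range s" unfolding \<sigma>_def by (rule Min_in) auto
  then obtain j0 where j0: "s j0 = \<sigma>" by auto
  have Rp: "R > 0" and \<sigma>p: "\<sigma> > 0" using rs i0 j0 by auto
  have "(\<Sum>j\<in>UNIV. T i0 j * (R * \<sigma> - 1)) \<le> (\<Sum>j\<in>UNIV. T i0 j * (r i0 * s j - 1))"
    by (intro sum_mono mult_left_mono T0) (use i0 s\<sigma> Rp in auto)
  then have "c $ i0 * (R * \<sigma> - 1) \<le> 0"
    unfolding rowd by (simp flip: sum_distrib_right add: row)
  then have 1: "R * \<sigma> \<le> 1"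
    using c[of i0] by (simp add: mult_le_0_iff)
  have "(\<Sum>i\<in>UNIV. T i j0 * (r i * s j0 - 1)) \<le> (\<Sum>i\<in>UNIV. T i j0 * (R * \<sigma> - 1))"
    by (intro sum_mono mult_left_mono T0) (use j0 rR \<sigma>p in auto)
  then have "0 \<le> d $ j0 * (R * \<sigma> - 1)"
    unfolding cold by (simp flip: sum_distrib_right add: col)
  then have 2: "R * \<sigma> \<ge> 1"
    using d[of j0] by (simp add: zero_le_mult_iff)
  from 1 2 have R\<sigma>: "R * \<sigma> = 1" by simp
  have ri: "s j = \<sigma>" if "r i = R" "A $ i $ j \<noteq> 0" for i j
  proof -
    \<comment> \<open>In an extremal row every term is nonnegative, because
      \<open>R * s j \<ge> R * \<sigma> = 1\<close>; as the terms sum to zero, each of them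
      vanishes.\<close>
    have "\<forall>j\<in>UNIV. T i j * (r i * s j - 1) = 0"
    proof (subst sum_nonneg_eq_0_iff[symmetric])
      show "0 \<le> T i j * (r i * s j - 1)" for j
        using mult_left_mono[OF s\<sigma>[of j], of R] Rp R\<sigma> T0[of i j] that(1) by simp
    qed (use rowd in auto)
    then have "R * s j = R * \<sigma>" using that Tz R\<sigma> by auto
    then show ?thesis using Rp by simp
  qed
  have sj: "r i = R" if "s j = \<sigma>" "A $ i $ j \<noteq> 0" for i j
  proof -
    have "\<forall>i\<in>UNIV. T i j * (1 - r i * s j) = 0"
    proof (subst sum_nonneg_eq_0_iff[symmetric])
      show "0 \<le> T i j * (1 - r i * s j)" for i
        using mult_right_mono[OF rR[of i], of \<sigma>] \<sigma>p R\<sigma> T0[of i j] that(1) by simp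
      show "(\<Sum>i\<in>UNIV. T i j * (1 - r i * s j)) = 0"
        by (simp add: right_diff_distrib sum_subtractf col col')
    qed auto
    then have "r i * \<sigma> = R * \<sigma>" using that Tz R\<sigma> by auto
    then show ?thesis using \<sigma>p by simp
  qed
  \<comment> \<open>Extremal rows are paired with non-extremal columns, so that \<open>ri\<close>
    and \<open>sj\<close> make both blocks in the connectedness condition zero.\<close>
  define I where "I = {i. r i = R}"
  define J where "J = {j. s j \<noteq> \<sigma>}"
  have z: "zero_block A (- I) (- J)" "zero_block A I J"
    using ri sj by (auto simp: zero_block_def I_def J_def)
  have "I \<noteq> {}" "J \<noteq> UNIV" using i0 j0 by (auto simp: I_def J_def)
  \<comment> \<open>Connectedness leaves only these two degenerate cases. Each implies the other,
    since otherwise a column or a row would be zero, against its positive sum.\<close>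
  then have "I = UNIV \<or> J = {}"
    using con z unfolding connected_matrix_def by blast
  moreover have "J = {}" if "I = UNIV"
  proof (rule ccontr)
    assume "J \<noteq> {}"
    then obtain j where "j \<in> J" by auto
    then have "T i j = 0" for i using z(2) that Tz by (auto simp: zero_block_def)
    then show False using col[of j] d[of j] by simp
  qed
  moreover have "I = UNIV" if "J = {}"
  proof (rule ccontr)
    assume "I \<noteq> UNIV"
    then obtain i where "i \<notin> I" by auto
    then have "T i j = 0" for j using z(1) that Tz by (auto simp: zero_block_def)
    then show False using row[of i] c[of i] by simp
  qed
  ultimately have all: "r i = R" "s j = \<sigma>" for i j
    by (auto simp: I_def J_def)
  show thesis
  proof
    show "R > 0" by (rule Rp)
    show "p' i = R * p i" for i
      using all(1)[of i] pos(1)[of i] by (simp add: r_def field_simps)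
    have "\<sigma> = 1 / R" using R\<sigma> Rp by (simp add: field_simps)
    then show "q' j = q j / R" for j
      using all(2)[of j] pos(2)[of j] by (simp add: s_def field_simps)
  qed
qed

section \<open>Consequences of the conditions for the weights\<close>

lemma compatible_row_nonzero:
  assumes c: "\<And>i. c $ i > 0" and comp: "compatible A c d"
  obtains j where "A $ i $ j \<noteq> 0"
proof -
  have "\<not> zero_block A {i} UNIV"
  proof
    assume "zero_block A {i} UNIV"
    then have "zero_block A (- (- {i})) (- {})" by simp
    then have "(\<Sum>i\<in>- (- {i}). c $ i) \<le> (\<Sum>j\<in>{}. d $ j)"
      using comp unfolding compatible_def by blast
    then show False using c[of i] by simp
  qed
  then show thesis using that by (auto simp: zero_block_def)
qed

lemma compatible_column_nonzero:
  assumes d: "\<And>j. d $ j > 0" and comp: "compatible A c d"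
  obtains i where "A $ i $ j \<noteq> 0"
proof -
  have "zero_block A (- UNIV) (- {j})" by (simp add: zero_block_def)
  then have "(\<Sum>i\<in>- UNIV. c $ i) < (\<Sum>j\<in>{j}. d $ j) \<longleftrightarrow> \<not> zero_block A UNIV {j}"
    using comp unfolding compatible_def by blast
  then have "\<not> zero_block A UNIV {j}" using d[of j] by simp
  then show thesis using that by (auto simp: zero_block_def)
qed

text \<open>For \<open>I = {}\<close> and \<open>J = UNIV\<close> both blocks are empty, so the
  compatibility inequality holds and is not strict.\<close>

lemma compatible_sum_eq:
  assumes "compatible A c d"
  shows "(\<Sum>i\<in>UNIV. c $ i) = (\<Sum>j\<in>UNIV. d $ j)"
proof -
  have "zero_block A (- {}) (- UNIV)" "zero_block A {} UNIV" by (auto simp: zero_block_def)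
  then have "(\<Sum>i\<in>- {}. c $ i) \<le> (\<Sum>j\<in>UNIV. d $ j)" "\<not> (\<Sum>i\<in>- {}. c $ i) < (\<Sum>j\<in>UNIV. d $ j)"
    using assms unfolding compatible_def by blast+
  then show ?thesis by simp
qed

text \<open>Compatibility for \<open>I = - S\<close>, with \<open>J\<close> the set of columns that
  \<open>S\<close> meets, gives the inequality without \<epsilon>. Connectedness makes it strict,
  and as there are finitely many \<open>S\<close>, one \<epsilon> serves all.\<close>

lemma neighbourhood_weight_gap:
  fixes A :: "real ^ 'm::finite ^ 'n::finite"
  assumes c: "\<And>i. c $ i > 0" and d: "\<And>j. d $ j > 0"
    and comp: "compatible A c d" and con: "connected_matrix A"
  obtains \<epsilon> where "\<epsilon> > 0"
    "\<And>S. S \<noteq> {} \<Longrightarrow> S \<noteq> UNIV \<Longrightarrow>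
       (\<Sum>i\<in>S. c $ i) + \<epsilon> \<le> (\<Sum>j\<in>{j. \<exists>i\<in>S. A $ i $ j \<noteq> 0}. d $ j)"
proof -
  define gap where "gap S = (\<Sum>j\<in>{j. \<exists>i\<in>S. A $ i $ j \<noteq> 0}. d $ j) - (\<Sum>i\<in>S. c $ i)" for S
  have gap: "gap S > 0" if S: "S \<noteq> {}" "S \<noteq> UNIV" for S
  proof -
    define J where "J = {j. \<exists>i\<in>S. A $ i $ j \<noteq> 0}"
    have z: "zero_block A (- (- S)) (- J)" by (auto simp: zero_block_def J_def)
    obtain i where i: "i \<in> S" using S by auto
    obtain j where "A $ i $ j \<noteq> 0" using compatible_row_nonzero[OF c comp] by blast
    then have J: "J \<noteq> {}" using i by (auto simp: J_def)
    have "\<not> zero_block A (- S) J"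
    \<comment> \<open>Connectedness speaks only of proper \<open>J\<close>; for the full
      \<open>J\<close> a nonzero entry in a row outside \<open>S\<close> takes its place.\<close>
    proof (cases "J = UNIV")
      case True
      obtain k where k: "k \<notin> S" using S by auto
      obtain j where "A $ k $ j \<noteq> 0" using compatible_row_nonzero[OF c comp] by blast
      with k True show ?thesis by (auto simp: zero_block_def)
    next
      case False
      have "- S \<noteq> {}" "- S \<noteq> UNIV" using S by auto
      then show ?thesis
        using con[unfolded connected_matrix_def, rule_format, of "- S" J] z J False by simp
    qed
    then have "(\<Sum>i\<in>- (- S). c $ i) < (\<Sum>j\<in>J. d $ j)"
      using comp z unfolding compatible_def by blast
    then show ?thesis by (simp add: gap_def J_def)
  qed
  \<comment> \<open>The element 1 keeps the minimum defined when there is a single row and hence no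
    nonempty proper \<open>S\<close>.\<close>
  define \<epsilon> where "\<epsilon> = Min (insert 1 (gap ` {S. S \<noteq> {} \<and> S \<noteq> UNIV}))"
  have "\<epsilon> > 0" unfolding \<epsilon>_def using gap by (subst Min_gr_iff) auto
  moreover have "(\<Sum>i\<in>S. c $ i) + \<epsilon> \<le> (\<Sum>j\<in>{j. \<exists>i\<in>S. A $ i $ j \<noteq> 0}. d $ j)"
    if "S \<noteq> {}" "S \<noteq> UNIV" for S
  proof -
    have "\<epsilon> \<le> gap S" unfolding \<epsilon>_def by (rule Min_le) (use that in auto)
    then show ?thesis by (simp add: gap_def)
  qed
  ultimately show thesis by (rule that)
qed

text \<open>A discrete layer-cake argument: cut \<open>a\<close> off at its second largest value and use the gap for
  the set where \<open>a\<close> attains its maximum.\<close>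

lemma potential_difference_bound:
  fixes A :: "real ^ 'm::finite ^ 'n::finite" and a :: "'n \<Rightarrow> real"
  assumes d: "\<And>j. d $ j > 0" and comp: "compatible A c d" and eps: "\<epsilon> > 0"
    and gap: "\<And>S. S \<noteq> {} \<Longrightarrow> S \<noteq> UNIV \<Longrightarrow>
       (\<Sum>i\<in>S. c $ i) + \<epsilon> \<le> (\<Sum>j\<in>{j. \<exists>i\<in>S. A $ i $ j \<noteq> 0}. d $ j)"
    and ab: "\<And>i j. A $ i $ j \<noteq> 0 \<Longrightarrow> a i \<le> b j"
  shows "(\<Sum>i\<in>UNIV. c $ i * a i) - (\<Sum>j\<in>UNIV. d $ j * b j) \<le> - \<epsilon> * (a k - a l)"
  using ab
\<comment> \<open>Each truncation removes the top value of \<open>a\<close>. Since \<open>b\<close>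
  is truncated along with \<open>a\<close>, it must be generalised too.\<close>
proof (induction "card (range a)" arbitrary: a b k l rule: less_induct)
  case less
  define m where "m = Max (range a)"
  have am: "a i \<le> m" for i by (simp add: m_def)
  define S where "S = {i. a i = m}"
  have "m \<in> range a" unfolding m_def by (rule Max_in) auto
  then have S0: "S \<noteq> {}" by (auto simp: S_def)
  show ?case
  proof (cases "S = UNIV")
    case True
    then have a: "a i = m" for i by (auto simp: S_def)
    have b: "m \<le> b j" for j
      using compatible_column_nonzero[OF d comp, of j] less.prems a by metis
    \<comment> \<open>For constant \<open>a\<close> the right-hand side is zero, and equal total
      weights settle the claim.\<close>
    have "(\<Sum>j\<in>UNIV. d $ j * m) \<le> (\<Sum>j\<in>UNIV. d $ j * b j)"
      by (intro sum_mono mult_left_mono b less_imp_le[OF d])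
    then show ?thesis
      by (simp add: a compatible_sum_eq[OF comp] flip: sum_distrib_right)
  next
    case False
    define n where "n = Max (a ` (- S))"
    have "n \<in> a ` (- S)" unfolding n_def by (rule Max_in) (use False in auto)
    then obtain i1 where i1: "i1 \<notin> S" "a i1 = n" by auto
    have nm: "n < m" using i1 am[of i1] by (auto simp: S_def)
    have an: "a i \<le> n" if "i \<notin> S" for i
      unfolding n_def by (rule Max_ge) (use that in auto)
    \<comment> \<open>Truncating both families at the same level preserves the constraint
      \<open>a i \<le> b j\<close> on nonzero entries.\<close>
    define a' where "a' i = min (a i) n" for i
    define b' where "b' j = min (b j) n" for j
    have a': "a i = a' i + (if i \<in> S then m - n else 0)" for i
      using an[of i] nm by (auto simp: a'_def S_def)
    have "range a' \<subseteq> range a"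
      using i1 by (auto simp: a'_def min_def)
    moreover have "m \<in> range a" "m \<notin> range a'"
      using \<open>m \<in> range a\<close> nm by (auto simp: a'_def min_def split: if_splits)
    ultimately have "range a' \<subset> range a" by blast
    then have "card (range a') < card (range a)" by (intro psubset_card_mono) auto
    moreover have "a' i \<le> b' j" if "A $ i $ j \<noteq> 0" for i j
      using less.prems[OF that] by (auto simp: a'_def b'_def)
    ultimately have IH: "(\<Sum>i\<in>UNIV. c $ i * a' i) - (\<Sum>j\<in>UNIV. d $ j * b' j) \<le> - \<epsilon> * (a' k - a' l)"
      by (rule less.hyps)
    define J where "J = {j. \<exists>i\<in>S. A $ i $ j \<noteq> 0}"
    \<comment> \<open>A column met by \<open>S\<close> has \<open>b j \<ge> m\<close>, so truncation
      at \<open>n\<close> costs it at least \<open>m - n\<close>.\<close>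
    have b': "b j \<ge> b' j + (if j \<in> J then m - n else 0)" for j
    proof (cases "j \<in> J")
      case True
      then have "b j \<ge> m" using less.prems by (force simp: J_def S_def)
      then show ?thesis using True by (auto simp: b'_def)
    qed (auto simp: b'_def)
    have "(\<Sum>i\<in>UNIV. c $ i * a i)
        = (\<Sum>i\<in>UNIV. c $ i * a' i) + (\<Sum>i\<in>UNIV. if i \<in> S then c $ i * (m - n) else 0)"
      unfolding sum.distrib[symmetric] by (intro sum.cong refl) (simp add: a' distrib_left)
    also have "(\<Sum>i\<in>UNIV. if i \<in> S then c $ i * (m - n) else 0) = (\<Sum>i\<in>S. c $ i) * (m - n)"
      by (simp add: sum_distrib_right flip: sum.inter_filter)
    finally have ca: "(\<Sum>i\<in>UNIV. c $ i * a i)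
        = (\<Sum>i\<in>UNIV. c $ i * a' i) + (\<Sum>i\<in>S. c $ i) * (m - n)" .
    have "(\<Sum>j\<in>J. d $ j) * (m - n) = (\<Sum>j\<in>UNIV. if j \<in> J then d $ j * (m - n) else 0)"
      by (simp add: sum_distrib_right flip: sum.inter_filter)
    then have "(\<Sum>j\<in>UNIV. d $ j * b' j) + (\<Sum>j\<in>J. d $ j) * (m - n)
        = (\<Sum>j\<in>UNIV. d $ j * (b' j + (if j \<in> J then m - n else 0)))"
      unfolding distrib_left sum.distrib by (simp add: if_distrib cong: if_cong)
    also have "\<dots> \<le> (\<Sum>j\<in>UNIV. d $ j * b j)"
      by (intro sum_mono mult_left_mono b' less_imp_le[OF d])
    finally have db: "(\<Sum>j\<in>UNIV. d $ j * b' j) + (\<Sum>j\<in>J. d $ j) * (m - n)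
        \<le> (\<Sum>j\<in>UNIV. d $ j * b j)" .
    have "((\<Sum>i\<in>S. c $ i) + \<epsilon>) * (m - n) \<le> (\<Sum>j\<in>J. d $ j) * (m - n)"
      using gap[OF S0 False] nm by (intro mult_right_mono) (auto simp: J_def)
    then have g: "(\<Sum>i\<in>S. c $ i) * (m - n) + \<epsilon> * (m - n) \<le> (\<Sum>j\<in>J. d $ j) * (m - n)"
      by (simp add: distrib_right)
    \<comment> \<open>Truncation shrinks a difference by at most \<open>m - n\<close>, and the gap
      for \<open>S\<close> pays for this with \<open>\<epsilon> * (m - n)\<close>.\<close>
    have "a k - a l \<le> a' k - a' l + (m - n)" using a'[of k] a'[of l] nm by auto
    then have "\<epsilon> * (a k - a l) \<le> \<epsilon> * (a' k - a' l) + \<epsilon> * (m - n)"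
      using eps by (simp flip: distrib_left)
    then show ?thesis using IH ca db g by simp
  qed
qed

section \<open>Existence by maximising the concave function\<close>

lemma scaling_exists:
  fixes A :: "real ^ 'm::finite ^ 'n::finite"
  assumes A: "\<And>i j. A $ i $ j \<ge> 0" and c: "\<And>i. c $ i > 0" and d: "\<And>j. d $ j > 0"
    and comp: "compatible A c d" and con: "connected_matrix A"
  obtains p q where "scaling A c d p q"
proof -
  obtain \<epsilon> where eps: "\<epsilon> > 0" and gap: "\<And>S. S \<noteq> {} \<Longrightarrow> S \<noteq> UNIV \<Longrightarrow>
       (\<Sum>i\<in>S. c $ i) + \<epsilon> \<le> (\<Sum>j\<in>{j. \<exists>i\<in>S. A $ i $ j \<noteq> 0}. d $ j)"
    using neighbourhood_weight_gap[OF c d comp con] by blast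
  define w where "w a j = (\<Sum>k\<in>UNIV. A $ k $ j * exp (a $ k))" for a :: "real ^ 'n" and j
  define h where "h a = (\<Sum>i\<in>UNIV. c $ i * a $ i) - (\<Sum>j\<in>UNIV. d $ j * ln (w a j))" for a
  have wge: "A $ i $ j * exp (a $ i) \<le> w a j" for a i j
    unfolding w_def
    by (rule member_le_sum[of i UNIV "\<lambda>k. A $ k $ j * exp (a $ k)"]) (use A in auto)
  have wpos: "w a j > 0" for a j
  proof -
    obtain i where "A $ i $ j \<noteq> 0" using compatible_column_nonzero[OF d comp] by blast
    then have "A $ i $ j * exp (a $ i) > 0" using A[of i j] by simp
    then show ?thesis using wge[of i j a] by linarith
  qed
  \<comment> \<open>A positive lower bound for the nonzero entries: it gives
    \<open>w a j \<ge> \<alpha> * exp (a $ i)\<close> whenever \<open>A $ i $ j \<noteq> 0\<close>.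
    Hence \<open>ln (w a j) - ln \<alpha>\<close> can serve as \<open>b j\<close> in the bound
    above, and \<open>K\<close> collects the resulting \<open>ln \<alpha>\<close> terms.\<close>
  define \<alpha> where "\<alpha> = Min (insert 1 {A $ i $ j |i j. A $ i $ j \<noteq> 0})"
  have fin: "finite {A $ i $ j |i j. A $ i $ j \<noteq> 0}"
    by (rule finite_subset[of _ "range (\<lambda>(i, j). A $ i $ j)"]) auto
  have \<alpha>: "\<alpha> > 0" unfolding \<alpha>_def using fin A
    by (subst Min_gr_iff) (auto simp: less_le)
  have \<alpha>A: "\<alpha> \<le> A $ i $ j" if "A $ i $ j \<noteq> 0" for i j
    unfolding \<alpha>_def by (rule Min_le) (use fin that in auto)
  define K where "K = - (\<Sum>j\<in>UNIV. d $ j) * ln \<alpha>"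
  have hbound: "h a \<le> K - \<epsilon> * (a $ k - a $ l)" for a k l
  proof -
    have "a $ i \<le> ln (w a j) - ln \<alpha>" if "A $ i $ j \<noteq> 0" for i j
    proof -
      have "\<alpha> * exp (a $ i) \<le> w a j"
        using mult_right_mono[OF \<alpha>A[OF that], of "exp (a $ i)"] wge[of i j a]
        by (meson exp_ge_zero order_trans)
      then have "ln (\<alpha> * exp (a $ i)) \<le> ln (w a j)"
        using \<alpha> wpos by (subst ln_le_cancel_iff) auto
      then show ?thesis using \<alpha> by (simp add: ln_mult)
    qed
    then have "(\<Sum>i\<in>UNIV. c $ i * a $ i) - (\<Sum>j\<in>UNIV. d $ j * (ln (w a j) - ln \<alpha>))
        \<le> - \<epsilon> * (a $ k - a $ l)"
      by (intro potential_difference_bound[where b = "\<lambda>j. ln (w a j) - ln \<alpha>", OF d comp eps gap])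
    then show ?thesis
      by (simp add: h_def K_def right_diff_distrib sum_subtractf sum_distrib_right)
  qed
  have hshift: "h (\<chi> i. a $ i - t) = h a" for a t
  proof -
    have "w (\<chi> i. a $ i - t) j = w a j * exp (- t)" for j
      unfolding w_def sum_distrib_right
      by (intro sum.cong refl) (simp add: exp_diff exp_minus field_simps)
    then have "ln (w (\<chi> i. a $ i - t) j) = ln (w a j) - t" for j
      using wpos[of a j] by (simp add: ln_mult)
    then show ?thesis
      by (simp add: h_def right_diff_distrib sum_subtractf compatible_sum_eq[OF comp]
          flip: sum_distrib_right)
  qed
  have cont: "continuous_on UNIV h"
    unfolding h_def w_def using wpos[unfolded w_def]
    by (intro continuous_intros) (auto simp: less_imp_neq[THEN not_sym])
  \<comment> \<open>The radius solves \<open>K - \<epsilon> * r = h 0\<close>: a point whose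
    coordinates spread by more than \<open>r\<close> cannot beat the origin.\<close>
  define r where "r = (K - h 0) / \<epsilon>"
  have r: "r \<ge> 0" using hbound[of 0 undefined undefined] eps by (simp add: r_def)
  define B where "B = cbox (\<chi> i::'n. - r) (\<chi> i. r)"
  have memB: "a \<in> B \<longleftrightarrow> (\<forall>i. \<bar>a $ i\<bar> \<le> r)" for a :: "real ^ 'n"
    by (auto simp: B_def mem_box_cart abs_le_iff minus_le_iff)
  have "compact B" "B \<noteq> {}" using memB[of 0] r by (auto simp: B_def)
  then obtain a where a: "a \<in> B" "\<And>x. x \<in> B \<Longrightarrow> h x \<le> h a"
    using continuous_attains_sup[of B h] continuous_on_subset[OF cont] by blast
  have hmax: "h x \<le> h a" for x
  proof -
    fix k :: 'n
    \<comment> \<open>Shift invariance allows coordinate \<open>k\<close> to be normalised to zero;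
      leaving the box then means that two coordinates of \<open>x\<close> differ by more than
      \<open>r\<close>.\<close>
    define y where "y = (\<chi> i. x $ i - x $ k)"
    have hy: "h x = h y" by (simp add: y_def hshift)
    show ?thesis
    proof (cases "y \<in> B")
      case False
      then obtain i where "\<bar>y $ i\<bar> > r" by (auto simp: memB not_le)
      then obtain k' l' where "x $ k' - x $ l' > r"
        by (cases "y $ i > 0") (auto simp: y_def)
      then have "\<epsilon> * (x $ k' - x $ l') \<ge> K - h 0"
        using eps by (simp add: r_def field_simps)
      then have "h x \<le> h 0" using hbound[of x k' l'] by simp
      also have "h 0 \<le> h a" by (rule a) (simp add: memB r)
      finally show ?thesis .
    qed (use a hy in auto)
  qed
  have crit: "c $ i = (\<Sum>j\<in>UNIV. exp (a $ i) * A $ i $ j * (d $ j / w a j))" for i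
  proof -
    \<comment> \<open>Only coordinate \<open>i\<close> moves along this curve, so the vanishing
      derivative at the maximum is the equation of row \<open>i\<close>.\<close>
    define u where "u t = (\<chi> k. a $ k + (if k = i then t else 0))" for t :: real
    have u0: "u 0 = a" by (simp add: u_def vec_eq_iff)
    have Du: "((\<lambda>t. u t $ k) has_real_derivative (if k = i then 1 else 0)) (at 0)" for k
      unfolding u_def by (auto intro!: derivative_eq_intros)
    have Dw: "((\<lambda>t. w (u t) j) has_real_derivative A $ i $ j * exp (a $ i)) (at 0)" for j
    proof -
      have "((\<lambda>t. w (u t) j) has_real_derivative
          (\<Sum>k\<in>UNIV. A $ k $ j * (exp (u 0 $ k) * (if k = i then 1 else 0)))) (at 0)"
        unfolding w_def
        by (intro DERIV_sum DERIV_cmult DERIV_chain2[OF DERIV_exp] Du)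
      also have "(\<Sum>k\<in>UNIV. A $ k $ j * (exp (u 0 $ k) * (if k = i then 1 else 0)))
          = (\<Sum>k\<in>UNIV. if k = i then A $ k $ j * exp (a $ k) else 0)"
        by (intro sum.cong) (auto simp: u0)
      finally show ?thesis by simp
    qed
    have "((\<lambda>t. h (u t)) has_real_derivative
        (\<Sum>k\<in>UNIV. c $ k * (if k = i then 1 else 0))
        - (\<Sum>j\<in>UNIV. d $ j * (inverse (w (u 0) j) * (A $ i $ j * exp (a $ i))))) (at 0)"
      unfolding h_def
      by (intro DERIV_diff DERIV_sum DERIV_cmult Du DERIV_chain2[OF DERIV_ln] Dw wpos)
    then have "(\<Sum>k\<in>UNIV. c $ k * (if k = i then 1 else 0))
        - (\<Sum>j\<in>UNIV. d $ j * (inverse (w (u 0) j) * (A $ i $ j * exp (a $ i)))) = 0"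
      by (rule DERIV_local_max[where d = 1]) (auto simp: u0 hmax)
    moreover have "(\<Sum>k\<in>UNIV. c $ k * (if k = i then 1 else 0)) = c $ i"
      by (simp add: if_distrib cong: if_cong)
    ultimately show ?thesis
      by (simp add: u0 divide_inverse mult_ac)
  qed
  \<comment> \<open>The column sums come out right for every \<open>a\<close>, by the choice of
    \<open>q\<close>.\<close>
  have "(\<Sum>i\<in>UNIV. exp (a $ i) * A $ i $ j * (d $ j / w a j)) = d $ j" for j
  proof -
    have "(\<Sum>i\<in>UNIV. exp (a $ i) * A $ i $ j * (d $ j / w a j)) = w a j * (d $ j / w a j)"
      unfolding w_def[of a j] sum_distrib_right by (simp add: mult_ac)
    then show ?thesis using wpos[of a j] by simp
  qed
  then have "scaling A c d (\<lambda>i. exp (a $ i)) (\<lambda>j. d $ j / w a j)"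
    unfolding scaling_def using crit d wpos by simp
  then show thesis by (rule that)
qed

section \<open>The equivalence for the original system\<close>

theorem theorem4:
  fixes f :: "'m::finite \<Rightarrow> real \<Rightarrow> real"
    and g :: "'n::finite \<Rightarrow> real \<Rightarrow> real"
    and A :: "real ^ 'm ^ 'n"
    and c :: "real ^ 'n"
    and d :: "real ^ 'm"
  assumes "\<And>j. bij_betw (f j) {0<..} {0<..}"
    and "\<And>i. bij_betw (g i) {0<..} {0<..}"
    and "\<And>i j. A $ i $ j \<ge> 0"
    and "\<And>i. c $ i > 0"
    and "\<And>j. d $ j > 0"
  shows "unique_positive_solution_up_to_scalar f g A c d \<longleftrightarrow>
           compatible A c d \<and> connected_matrix A"
proof
  note to_scaling = positive_solution_imp_scaling[where f = f and g = g, OF assms(1,2,4,5)]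
  note from_scaling = scaling_imp_positive_solution[where f = f and g = g, OF assms(1,2,4,5)]
  assume U: "unique_positive_solution_up_to_scalar f g A c d"
  then obtain x0 y0 where "positive_solution f g A c d x0 y0"
    by (auto simp: unique_positive_solution_up_to_scalar_def)
  then obtain p q where sc: "scaling A c d p q" using to_scaling by blast
  have q: "q j > 0" for j using sc by (simp add: scaling_def)
  obtain x y where xy: "positive_solution f g A c d x y" "\<And>j. f j (x $ j) = d $ j / q j"
    using from_scaling[OF sc] by metis
  have "connected_matrix A"
    unfolding connected_matrix_def
  proof (intro allI impI notI, elim conjE)
    fix I J
    assume J: "J \<noteq> {}" "J \<noteq> UNIV" and z: "zero_block A (- I) (- J)" "zero_block A I J"
    \<comment> \<open>Rescaling with \<open>t = 2\<close> keeps the values of \<open>f\<close> on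
      \<open>J\<close> and doubles them off \<open>J\<close>, so no single \<delta> relates the two
      solutions.\<close>
    obtain x' y' where xy': "positive_solution f g A c d x' y'"
      "\<And>j. f j (x' $ j) = d $ j / (if j \<in> J then q j else q j / 2)"
      using from_scaling[OF scaling_rescale_blocks[OF sc z, of 2]] by (metis zero_less_numeral)
    obtain \<delta> where \<delta>: "\<And>j. f j (x' $ j) = \<delta> * f j (x $ j)"
      using U xy(1) xy'(1) unfolding unique_positive_solution_up_to_scalar_def by blast
    obtain j k where jk: "j \<in> J" "k \<notin> J" using J by auto
    have "\<delta> = 1" using \<delta>[of j] jk assms(5)[of j] q[of j] by (simp add: xy xy')
    moreover have "\<delta> = 2" using \<delta>[of k] jk assms(5)[of k] q[of k] by (simp add: xy xy')
    ultimately show False by simp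
  qed
  with scaling_imp_compatible[OF assms(3) sc] show "compatible A c d \<and> connected_matrix A" ..
next
  note to_scaling = positive_solution_imp_scaling[where f = f and g = g, OF assms(1,2,4,5)]
  assume cc: "compatible A c d \<and> connected_matrix A"
  then obtain p q where "scaling A c d p q"
    using scaling_exists[OF assms(3-5)] by blast
  then have ex: "\<exists>x y. positive_solution f g A c d x y"
    using scaling_imp_positive_solution[where f = f and g = g, OF assms(1,2,4,5)] by metis
  have "\<exists>\<delta>>0. (\<forall>j. f j (x' $ j) = \<delta> * f j (x $ j)) \<and> (\<forall>i. g i (y' $ i) = inverse \<delta> * g i (y $ i))"
    if s: "positive_solution f g A c d x y" "positive_solution f g A c d x' y'" for x y x' y'
  proof -
    \<comment> \<open>The values of \<open>f\<close> and \<open>g\<close> are inverse to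
      \<open>q\<close> and \<open>p\<close>, so the factor \<open>R\<close> from \<open>p\<close> to
      \<open>p'\<close> is exactly the required \<delta>.\<close>
    obtain R where R: "R > 0" "\<And>i. c $ i / g i (y' $ i) = R * (c $ i / g i (y $ i))"
      "\<And>j. d $ j / f j (x' $ j) = d $ j / f j (x $ j) / R"
      using scaling_unique[OF assms(3-5) conjunct2[OF cc] to_scaling[OF s(1)] to_scaling[OF s(2)]]
      by metis
    have pos: "f j (x $ j) > 0" "f j (x' $ j) > 0" "g i (y $ i) > 0" "g i (y' $ i) > 0" for i j
      using s bij_betw_apply[OF assms(1)] bij_betw_apply[OF assms(2)]
      unfolding positive_solution_def by (metis greaterThan_iff)+
    have "f j (x' $ j) = R * f j (x $ j)" for j
      using R(1) R(3)[of j] pos(1,2)[of j] assms(5)[of j] by (simp add: field_simps)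
    moreover have "g i (y' $ i) = inverse R * g i (y $ i)" for i
      using R(1) R(2)[of i] pos(3,4)[of i] assms(4)[of i] by (simp add: field_simps)
    ultimately show ?thesis using R(1) by blast
  qed
  with ex show "unique_positive_solution_up_to_scalar f g A c d"
    unfolding unique_positive_solution_up_to_scalar_def by blast
qed

end
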